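(* Let $x\in\mathcal D$, let $\mathrm{Proj}_x$ be a linear projector of $\mathcal E$ onto $\mathrm T_x\mathcal M_x=\ker\mathrm Dc(x)$, set $\mathrm N_x\mathcal M_x=\ker\mathrm{Proj}_x$ and $\mathrm{Proj}_x^\perp=\mathrm{Id}_{\mathcal E}-\mathrm{Proj}_x$, let $G_T(x):\mathcal E\to\mathcal E$ be Euclidean-symmetric and positive definite on $\mathrm T_x\mathcal M_x$, and let $H(x):\mathcal F\to\mathcal F$ be symmetric positive definite. Let $g_0$ be any inner product on $\mathcal E$ for which $\mathrm T_x\mathcal M_x$ and $\mathrm N_x\mathcal M_x$ are orthogonal, and consider the pseudoinverse normal step $$d_N(x)=-\mathrm Dc(x)^{\dagger,g_0}H(x)c(x)=-\mathrm{Proj}_x^\perp\mathrm Dc(x)^{\dagger,\mathcal E}H(x)c(x).$$ Set $G_N(x)=\mathrm Dc(x)^{*,\mathcal E}H(x)^{-1}\mathrm Dc(x)$. Then $G_N(x)$ is symmetric and positive definite on $\mathrm N_x\mathcal M_x$, and for the metric $$g(\xi,\zeta)=\langle\mathrm{Proj}_x\xi,G_T(x)\mathrm{Proj}_x\zeta\rangle_{\mathcal E}+\langle\mathrm{Proj}_x^\perp\xi,G_N(x)\mathrm{Proj}_x^\perp\zeta\rangle_{\mathcal E}$$ one has $$d_N(x)=-\nabla_g\psi(x),\qquad \psi(x)=\tfrac12\|c(x)\|_{\mathcal F}^2.$$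
   Context: $\mathcal E,\mathcal F$ are finite-dimensional Euclidean spaces, $m=\dim\mathcal F<\dim\mathcal E$; $c:\mathcal E\to\mathcal F$ is continuously differentiable; $\mathcal D=\{x\in\mathcal E:\operatorname{rank}\mathrm Dc(x)=m\}$; $\mathcal M_x=\{y:c(y)=c(x)\}$. $A^{*,\mathcal E}$ is the Euclidean adjoint of $A:\mathcal E\to\mathcal F$; for an inner product $g_0$ on $\mathcal E$, $A^{*,g_0}:\mathcal F\to\mathcal E$ is defined by $\langle A\xi,y\rangle_{\mathcal F}=g_0(\xi,A^{*,g_0}y)$. $\mathrm Dc(x)^{\dagger,g_0}=\mathrm Dc(x)^{*,g_0}(\mathrm Dc(x)\mathrm Dc(x)^{*,g_0})^{-1}$, and $\mathrm Dc(x)^{\dagger,\mathcal E}$ is the same expression with Euclidean adjoints. $\nabla_g\psi(x)$ is the unique vector of $\mathcal E$ with $g(\nabla_g\psi(x),\xi)=\mathrm D\psi(x)[\xi]$ for all $\xi\in\mathcal E$. *)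

theory Defs
  imports "HOL-Analysis.Analysis"
begin

definition kernel :: "('a::real_vector \<Rightarrow> 'b::real_vector) \<Rightarrow> 'a set" where
  "kernel A = {v. A v = 0}"

definition regular_points ::
    "('e::euclidean_space \<Rightarrow> 'e \<Rightarrow>\<^sub>L 'f::euclidean_space) \<Rightarrow> 'e set" where
  "regular_points Dc = {x. dim (range (blinfun_apply (Dc x))) = DIM('f)}"

definition projector_onto :: "('a::real_vector \<Rightarrow> 'a) \<Rightarrow> 'a set \<Rightarrow> bool" where
  "projector_onto P T \<longleftrightarrow> linear P \<and> P \<circ> P = P \<and> range P = T"

definition is_inner_product :: "('a::real_vector \<Rightarrow> 'a \<Rightarrow> real) \<Rightarrow> bool" where
  "is_inner_product g \<longleftrightarrow>
     bilinear g \<and> (\<forall>u v. g u v = g v u) \<and> (\<forall>u. u \<noteq> 0 \<longrightarrow> 0 < g u u)"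

definition symmetric_on :: "'a::real_inner set \<Rightarrow> ('a \<Rightarrow> 'a) \<Rightarrow> bool" where
  "symmetric_on S A \<longleftrightarrow> (\<forall>u\<in>S. \<forall>v\<in>S. A u \<bullet> v = u \<bullet> A v)"

definition positive_definite_on :: "'a::real_inner set \<Rightarrow> ('a \<Rightarrow> 'a) \<Rightarrow> bool" where
  "positive_definite_on S A \<longleftrightarrow> (\<forall>u\<in>S. u \<noteq> 0 \<longrightarrow> 0 < u \<bullet> A u)"

text \<open>The codomain always carries its Euclidean inner product; only the inner product of
  the domain varies. The Euclidean adjoint is the library constant \<^const>\<open>adjoint\<close>.\<close>

definition adjoint_wrt ::
    "('e::real_vector \<Rightarrow> 'e \<Rightarrow> real) \<Rightarrow> ('e \<Rightarrow> 'f::real_inner) \<Rightarrow> 'f \<Rightarrow> 'e" where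
  "adjoint_wrt g A = (THE B. \<forall>\<xi> y. A \<xi> \<bullet> y = g \<xi> (B y))"

definition pseudoinverse_wrt ::
    "('e::real_vector \<Rightarrow> 'e \<Rightarrow> real) \<Rightarrow> ('e \<Rightarrow> 'f::real_inner) \<Rightarrow> 'f \<Rightarrow> 'e" where
  "pseudoinverse_wrt g A = adjoint_wrt g A \<circ> inv (A \<circ> adjoint_wrt g A)"

definition pseudoinverse :: "('e::real_inner \<Rightarrow> 'f::real_inner) \<Rightarrow> 'f \<Rightarrow> 'e" where
  "pseudoinverse A = adjoint A \<circ> inv (A \<circ> adjoint A)"

definition gradient_wrt ::
    "('e::real_normed_vector \<Rightarrow> 'e \<Rightarrow> real) \<Rightarrow> ('e \<Rightarrow> real) \<Rightarrow> 'e \<Rightarrow> 'e" where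
  "gradient_wrt g \<psi> x = (THE v. \<forall>\<xi>. g v \<xi> = frechet_derivative \<psi> (at x) \<xi>)"

end

theory Submission
  imports Defs
begin

text \<open>Write \<open>A = Dc x\<close>, \<open>z = H (c x)\<close>, and let \<open>w\<close>, \<open>p\<close> be the
  \<open>g\<^sub>0\<close>- and the Euclidean pseudoinverse applied to \<open>z\<close>. Then \<open>A w = A p = z\<close>, and
  \<open>w\<close> is \<open>g\<^sub>0\<close>-orthogonal to \<open>T\<close>, that is, \<open>w \<in> N\<close>. Since
  \<open>w - p \<in> T\<close>, it follows that \<open>w\<close> is the normal part of \<open>p\<close>. In
  \<open>g w \<xi>\<close> the tangential term vanishes and the normal one is
  \<open>A w \<bullet> inv H (A \<xi>) = c x \<bullet> A \<xi>\<close>, the derivative of \<open>\<psi>\<close> at \<open>x\<close>.\<close>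

section \<open>Inner products and Riesz representation\<close>

lemma is_inner_product_inner: "is_inner_product ((\<bullet>) :: 'a::real_inner \<Rightarrow> 'a \<Rightarrow> real)"
  by (auto simp: is_inner_product_def bilinear_def inner_commute
      intro!: linearI inner_left_distrib inner_right_distrib)

context
  fixes g :: "'e::real_vector \<Rightarrow> 'e \<Rightarrow> real"
  assumes g: "is_inner_product g"
begin

lemma is_inner_product_linear_right: "linear (g u)"
  and is_inner_product_linear_left: "linear (\<lambda>u. g u v)"
  using g by (auto simp: is_inner_product_def bilinear_def)

lemma is_inner_product_commute: "g u v = g v u"
  using g by (auto simp: is_inner_product_def)

lemma is_inner_product_eq_0_iff: "g u u = 0 \<longleftrightarrow> u = 0"
  using g linear_0[OF is_inner_product_linear_right]
  by (metis is_inner_product_def less_irrefl)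

lemma is_inner_product_eqI:
  assumes "\<And>\<xi>. g u \<xi> = g v \<xi>"
  shows "u = v"
proof -
  have "g (u - v) (u - v) = 0"
    using linear_diff[OF is_inner_product_linear_left] assms by simp
  then show ?thesis
    by (simp add: is_inner_product_eq_0_iff)
qed

end

text \<open>The Gram operator \<open>M\<close> expresses \<open>g\<close> through the Euclidean
  product. Definiteness of \<open>g\<close> makes it injective, hence onto in finite dimension, so
  \<open>v\<close> can be taken as a preimage under \<open>M\<close> of the Euclidean representative
  of \<phi>.\<close>

lemma is_inner_product_riesz:
  fixes g :: "'e::euclidean_space \<Rightarrow> 'e \<Rightarrow> real"
  assumes g: "is_inner_product g" and "linear \<phi>"
  shows "\<exists>v. \<forall>\<xi>. g v \<xi> = \<phi> \<xi>"
proof -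
  define M where "M u = (\<Sum>b\<in>Basis. g u b *\<^sub>R b)" for u
  have M_inner: "M u \<bullet> \<xi> = g u \<xi>" for u \<xi>
  proof -
    have "g u \<xi> = g u (\<Sum>b\<in>Basis. (\<xi> \<bullet> b) *\<^sub>R b)"
      by (simp add: euclidean_representation)
    also have "\<dots> = (\<Sum>b\<in>Basis. g u b * (b \<bullet> \<xi>))"
      using is_inner_product_linear_right[OF g]
      by (simp add: linear_sum linear_scale mult.commute inner_commute)
    finally show ?thesis
      by (simp add: M_def inner_sum_left)
  qed
  have "linear M"
    unfolding M_def
    by (intro linear_compose_sum ballI linearI)
      (simp_all add: linear_add[OF is_inner_product_linear_left[OF g]]
        linear_scale[OF is_inner_product_linear_left[OF g]] scaleR_add_left)
  moreover have "inj M"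
    by (intro injI is_inner_product_eqI[OF g]) (metis M_inner)
  ultimately have "surj M"
    by (rule linear_inj_imp_surj)
  \<comment> \<open>Read \<phi> as a map into the Euclidean line: its value at \<xi>, times 1, is
    the product of \<xi> with \<open>adjoint \<phi> 1\<close>.\<close>
  then obtain v where "M v = adjoint \<phi> 1"
    by (metis surjD)
  then have "g v \<xi> = \<phi> \<xi>" for \<xi>
    using adjoint_works[OF \<open>linear \<phi>\<close>, of \<xi> 1] M_inner[of v \<xi>] by (simp add: inner_commute)
  then show ?thesis by blast
qed

section \<open>Adjoints and pseudoinverses for a varying inner product\<close>

lemma adjoint_wrt_unique:
  assumes g: "is_inner_product g" and "\<And>\<xi> y. A \<xi> \<bullet> y = g \<xi> (B y)"
  shows "adjoint_wrt g A = B"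
  unfolding adjoint_wrt_def
proof (rule the_equality)
  fix B' assume B': "\<forall>\<xi> y. A \<xi> \<bullet> y = g \<xi> (B' y)"
  show "B' = B"
    by (intro ext is_inner_product_eqI[OF g])
      (metis B' assms(2) is_inner_product_commute[OF g])
qed (use assms in blast)

lemma adjoint_wrt_inner:
  fixes A :: "'e::euclidean_space \<Rightarrow> 'f::euclidean_space"
  assumes "linear A"
  shows "adjoint_wrt (\<bullet>) A = adjoint A"
  by (intro adjoint_wrt_unique is_inner_product_inner) (simp add: adjoint_works[OF assms])

text \<open>Makes the Euclidean pseudoinverse an instance of the general one, so that the
  right-inverse property needs only one proof.\<close>

lemma pseudoinverse_wrt_inner:
  fixes A :: "'e::euclidean_space \<Rightarrow> 'f::euclidean_space"
  assumes "linear A"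
  shows "pseudoinverse_wrt (\<bullet>) A = pseudoinverse A"
  by (simp add: pseudoinverse_wrt_def pseudoinverse_def adjoint_wrt_inner[OF assms])

lemma adjoint_wrt_works:
  fixes A :: "'e::euclidean_space \<Rightarrow> 'f::euclidean_space"
  assumes g: "is_inner_product g" and A: "linear A"
  shows "A \<xi> \<bullet> y = g \<xi> (adjoint_wrt g A y)"
proof -
  have "\<exists>v. \<forall>\<xi>. g v \<xi> = A \<xi> \<bullet> y" for y
    by (rule is_inner_product_riesz[OF g])
      (intro linearI; simp add: linear_add[OF A] linear_scale[OF A] inner_add_left)
  then obtain B where "\<And>y \<xi>. g (B y) \<xi> = A \<xi> \<bullet> y" by metis
  then have B: "A \<xi> \<bullet> y = g \<xi> (B y)" for \<xi> y
    by (metis is_inner_product_commute[OF g])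
  with adjoint_wrt_unique[OF g B] show ?thesis by simp
qed

lemma adjoint_wrt_linear:
  fixes A :: "'e::euclidean_space \<Rightarrow> 'f::euclidean_space"
  assumes g: "is_inner_product g" and A: "linear A"
  shows "linear (adjoint_wrt g A)"
proof -
  have g_adj: "g (adjoint_wrt g A y) \<xi> = A \<xi> \<bullet> y" for y \<xi>
    by (metis adjoint_wrt_works[OF g A] is_inner_product_commute[OF g])
  show ?thesis
    by (intro linearI; rule is_inner_product_eqI[OF g])
      (simp_all add: g_adj linear_add[OF is_inner_product_linear_left[OF g]]
        linear_scale[OF is_inner_product_linear_left[OF g]] inner_add_right)
qed

context
  fixes g :: "'e::euclidean_space \<Rightarrow> 'e \<Rightarrow> real" and A :: "'e \<Rightarrow> 'f::euclidean_space"
  assumes g: "is_inner_product g" and A: "linear A" "surj A"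
begin

text \<open>With \<open>B\<close> the adjoint, \<open>A (B y) \<bullet> y = g (B y) (B y)\<close>.
  Hence \<open>A (B y) = 0\<close> forces \<open>B y = 0\<close>, which makes \<open>y\<close>
  orthogonal to the range of \<open>A\<close>, that is, to everything. So \<open>A \<circ> B\<close>
  is injective on a finite-dimensional space, hence onto, and \<open>inv\<close> really inverts
  it.\<close>

lemma pseudoinverse_wrt_right_inverse: "A (pseudoinverse_wrt g A z) = z"
proof -
  let ?B = "adjoint_wrt g A"
  have lin: "linear (A \<circ> ?B)"
    by (intro linear_compose adjoint_wrt_linear g A)
  have "y = 0" if "(A \<circ> ?B) y = 0" for y
  proof -
    have "g (?B y) (?B y) = 0"
      using adjoint_wrt_works[OF g A(1), of "?B y" y] that by simp
    then have "?B y = 0"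
      by (simp add: is_inner_product_eq_0_iff[OF g])
    then have "A \<xi> \<bullet> y = 0" for \<xi>
      by (simp add: adjoint_wrt_works[OF g A(1)] linear_0[OF is_inner_product_linear_right[OF g]])
    then show ?thesis
      using A(2) by (metis inner_eq_zero_iff surjD)
  qed
  then have "inj (A \<circ> ?B)"
    by (simp add: linear_injective_0[OF lin])
  then have "surj (A \<circ> ?B)"
    by (rule linear_inj_imp_surj[OF lin])
  from surj_f_inv_f[OF this, of z] show ?thesis
    by (simp add: pseudoinverse_wrt_def)
qed

text \<open>The pseudoinverse takes values in the range of the adjoint, and
  \<open>g u (B y) = A u \<bullet> y\<close> vanishes for \<open>u\<close> in the kernel.\<close>

lemma pseudoinverse_wrt_orthogonal_kernel:
  assumes "u \<in> kernel A"
  shows "g u (pseudoinverse_wrt g A z) = 0"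
  using assms by (simp add: pseudoinverse_wrt_def kernel_def flip: adjoint_wrt_works[OF g A(1)])

end

section \<open>Inverse of the weight \<open>H\<close>\<close>

context
  fixes H :: "'f::euclidean_space \<Rightarrow> 'f"
  assumes H: "linear H" "positive_definite_on UNIV H"
begin

lemma positive_definite_bij: "bij H"
proof -
  have "inj H"
    using H(2) by (force simp: linear_injective_0[OF H(1)] positive_definite_on_def)
  then show ?thesis
    by (simp add: bij_def linear_inj_imp_surj[OF H(1)])
qed

lemma positive_definite_on_inv: "positive_definite_on UNIV (inv H)"
  unfolding positive_definite_on_def
proof (intro ballI impI)
  fix u :: 'f assume "u \<noteq> 0"
  \<comment> \<open>Substituting \<open>u = H s\<close> turns the quadratic form of
    \<open>inv H\<close> into that of \<open>H\<close>.\<close>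
  obtain s where s: "u = H s"
    using positive_definite_bij by (metis bij_pointE)
  with \<open>u \<noteq> 0\<close> have "s \<noteq> 0"
    using linear_0[OF H(1)] by auto
  then have "0 < s \<bullet> H s"
    using H(2) by (simp add: positive_definite_on_def)
  then show "0 < u \<bullet> inv H u"
    using positive_definite_bij by (simp add: s bij_is_inj inner_commute)
qed

lemma symmetric_on_inv:
  assumes "symmetric_on UNIV H"
  shows "symmetric_on UNIV (inv H)"
  unfolding symmetric_on_def
  using assms positive_definite_bij
  by (metis UNIV_I bij_inv_eq_iff symmetric_on_def)

end

lemma gradient_wrt_unique:
  assumes g: "is_inner_product g" and "(\<psi> has_derivative D) (at x)" and "\<And>\<xi>. g v \<xi> = D \<xi>"
  shows "gradient_wrt g \<psi> x = v"
proof -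
  have D: "frechet_derivative \<psi> (at x) = D"
    using frechet_derivative_at[OF assms(2)] by (rule sym)
  show ?thesis
    unfolding gradient_wrt_def D
    by (rule the_equality) (simp_all add: assms(3) is_inner_product_eqI[OF g])
qed

theorem proposition4p4:
  fixes c :: "'e::euclidean_space \<Rightarrow> 'f::euclidean_space"
    and Dc :: "'e \<Rightarrow> 'e \<Rightarrow>\<^sub>L 'f"
    and x :: 'e
    and Proj ProjPerp G_T G_N :: "'e \<Rightarrow> 'e"
    and H :: "'f \<Rightarrow> 'f"
    and g0 g :: "'e \<Rightarrow> 'e \<Rightarrow> real"
    and T N :: "'e set"
    and \<psi> :: "'e \<Rightarrow> real"
    and d_N :: 'e
  defines "T \<equiv> kernel (blinfun_apply (Dc x))"
    and "N \<equiv> kernel Proj"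
    and "ProjPerp \<equiv> (\<lambda>\<xi>. \<xi> - Proj \<xi>)"
    and "G_N \<equiv> adjoint (blinfun_apply (Dc x)) \<circ> inv H \<circ> blinfun_apply (Dc x)"
    and "g \<equiv> (\<lambda>\<xi> \<zeta>. Proj \<xi> \<bullet> G_T (Proj \<zeta>) + ProjPerp \<xi> \<bullet> G_N (ProjPerp \<zeta>))"
    and "\<psi> \<equiv> (\<lambda>y. (1/2) * (norm (c y))\<^sup>2)"
    and "d_N \<equiv> - pseudoinverse_wrt g0 (blinfun_apply (Dc x)) (H (c x))"
  assumes dims: "DIM('f) < DIM('e)"
    and deriv: "\<And>y. (c has_derivative blinfun_apply (Dc y)) (at y)"
    and cont: "continuous_on UNIV Dc"
    and x: "x \<in> regular_points Dc"
    and Proj: "projector_onto Proj T"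
    and G_T: "linear G_T" "symmetric_on T G_T" "positive_definite_on T G_T"
    and H: "linear H" "symmetric_on UNIV H" "positive_definite_on UNIV H"
    and g0: "is_inner_product g0"
    and orth: "\<forall>u\<in>T. \<forall>v\<in>N. g0 u v = 0"
  shows "d_N = - ProjPerp (pseudoinverse (blinfun_apply (Dc x)) (H (c x)))
    \<and> symmetric_on UNIV G_N \<and> positive_definite_on N G_N
    \<and> is_inner_product g
    \<and> d_N = - gradient_wrt g \<psi> x"
proof -
  let ?A = "blinfun_apply (Dc x)"
  define w where "w = pseudoinverse_wrt g0 ?A (H (c x))"
  define p where "p = pseudoinverse ?A (H (c x))"
  have A: "linear ?A"
    by (simp add: bounded_linear.linear blinfun.bounded_linear_right)
  \<comment> \<open>Regularity gives the range full dimension; being a subspace, it equals its span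
    and so is the whole codomain.\<close>
  have "subspace (range ?A)"
    by (intro linear_subspace_image A subspace_UNIV)
  then have surj: "surj ?A"
    using x dim_eq_full[of "range ?A"] span_eq_iff[of "range ?A"] by (simp add: regular_points_def)

  have P: "linear Proj" "Proj (Proj u) = Proj u" "?A (Proj u) = 0"
    "?A u = 0 \<Longrightarrow> Proj u = u" for u
  proof -
    have "Proj u \<in> T"
      using Proj by (auto simp: projector_onto_def)
    then show "?A (Proj u) = 0"
      by (simp add: T_def kernel_def)
    show *: "linear Proj" "Proj (Proj u) = Proj u" for u
      using Proj by (auto simp: projector_onto_def fun_eq_iff)
    show "Proj u = u" if "?A u = 0"
    proof -
      have "u \<in> range Proj"
        using that Proj by (simp add: projector_onto_def T_def kernel_def)
      with * show ?thesis by auto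
    qed
  qed
  have Perp: "linear ProjPerp"
    unfolding ProjPerp_def by (intro linear_compose_sub linear_ident P)
  have A_Perp: "?A (ProjPerp u) = ?A u" for u
    by (simp add: ProjPerp_def linear_diff[OF A] P)

  have A_w: "?A w = H (c x)"
    by (simp add: w_def pseudoinverse_wrt_right_inverse[OF g0 A surj])
  have A_p: "?A p = H (c x)"
    using pseudoinverse_wrt_right_inverse[OF is_inner_product_inner A surj]
    by (simp add: p_def pseudoinverse_wrt_inner[OF A])
  have Proj_w: "Proj w = 0"
  proof -
    \<comment> \<open>Both \<open>w\<close> and its component in \<open>N\<close> are
      \<open>g0\<close>-orthogonal to \<open>Proj w\<close>; hence so is their difference,
      \<open>Proj w\<close> itself.\<close>
    have "Proj w \<in> T" "w - Proj w \<in> N"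
      by (simp_all add: T_def N_def kernel_def linear_diff[OF P(1)] P)
    then have "g0 (Proj w) w = 0" "g0 (Proj w) (w - Proj w) = 0"
      using orth pseudoinverse_wrt_orthogonal_kernel[OF g0 A surj] by (simp_all add: w_def T_def)
    then have "g0 (Proj w) (Proj w) = 0"
      by (simp add: linear_diff[OF is_inner_product_linear_right[OF g0]])
    then show ?thesis
      by (simp add: is_inner_product_eq_0_iff[OF g0])
  qed
  \<comment> \<open>\<open>Proj\<close> fixes the kernel of the derivative. As
    \<open>Proj w = 0\<close>, the equation reads \<open>- Proj p = w - p\<close>.\<close>
  have "Proj (w - p) = w - p"
    by (rule P) (simp add: linear_diff[OF A] A_w A_p)
  then have step: "w = ProjPerp p"
    by (simp add: ProjPerp_def linear_diff[OF P(1)] Proj_w algebra_simps)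

  have bijH: "bij H" and symK: "symmetric_on UNIV (inv H)"
    and posK: "positive_definite_on UNIV (inv H)"
    by (intro positive_definite_bij symmetric_on_inv positive_definite_on_inv H)+
  have G_N: "u \<bullet> G_N v = ?A u \<bullet> inv H (?A v)" for u v
    by (simp add: G_N_def adjoint_works[OF A])
  have G_N_commute: "u \<bullet> G_N v = v \<bullet> G_N u" for u v
    using symK by (metis G_N UNIV_I inner_commute symmetric_on_def)
  then have symN: "symmetric_on UNIV G_N"
    by (simp add: symmetric_on_def inner_commute)
  have posN: "positive_definite_on N G_N"
    unfolding positive_definite_on_def
  proof (intro ballI impI)
    fix u assume "u \<in> N" "u \<noteq> 0"
    \<comment> \<open>\<open>Proj\<close> kills \<open>N\<close> but fixes the kernel of the
      derivative, so the two meet only in 0.\<close>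
    then have "?A u \<noteq> 0"
      using P(4)[of u] by (auto simp: N_def kernel_def)
    then show "0 < u \<bullet> G_N u"
      using posK by (simp add: G_N positive_definite_on_def)
  qed
  have linN: "linear G_N"
    unfolding G_N_def
    by (intro linear_compose A adjoint_linear inj_linear_imp_inv_linear H(1) bij_is_inj bijH
        linear_compose[OF A])

  \<comment> \<open>The form \<open>g\<close> is an inner product\<close>
  have g_commute: "g u v = g v u" for u v
  proof -
    \<comment> \<open>Symmetry of \<open>G_T\<close> is available on \<open>T\<close> only, so its
      arguments must be placed there first.\<close>
    have "Proj u \<in> T" for u
      by (simp add: T_def kernel_def P)
    with G_T(2) have "Proj u \<bullet> G_T (Proj v) = Proj v \<bullet> G_T (Proj u)"
      by (metis inner_commute symmetric_on_def)
    with G_N_commute show ?thesis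
      by (simp add: g_def)
  qed
  have "linear (g u)" for u
    unfolding g_def
    by (intro linearI)
      (simp_all add: linear_add[OF P(1)] linear_add[OF Perp] linear_add[OF G_T(1)] linear_add[OF linN]
        linear_scale[OF P(1)] linear_scale[OF Perp] linear_scale[OF G_T(1)] linear_scale[OF linN]
        inner_add_right algebra_simps)
  moreover from this have "linear (\<lambda>u. g u v)" for v
    by (simp add: g_commute[of _ v])
  ultimately have "bilinear g"
    by (simp add: bilinear_def)
  moreover have "0 < g u u" if "u \<noteq> 0" for u
  proof -
    have "Proj u \<in> T" "ProjPerp u \<in> N"
      by (simp_all add: T_def N_def kernel_def ProjPerp_def linear_diff[OF P(1)] P(2,3))
    then have pos: "Proj u \<noteq> 0 \<Longrightarrow> 0 < Proj u \<bullet> G_T (Proj u)"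
      "ProjPerp u \<noteq> 0 \<Longrightarrow> 0 < ProjPerp u \<bullet> G_N (ProjPerp u)"
      using G_T(3) posN by (auto simp: positive_definite_on_def)
    \<comment> \<open>Each block is nonnegative, being positive or evaluated at 0. Since
      \<open>u\<close> is the sum of its two components, at least one of them is nonzero and its
      block is strictly positive.\<close>
    then have "0 \<le> Proj u \<bullet> G_T (Proj u)" "0 \<le> ProjPerp u \<bullet> G_N (ProjPerp u)"
      by (metis inner_zero_left less_imp_le order_refl)+
    moreover from that have "Proj u \<noteq> 0 \<or> ProjPerp u \<noteq> 0"
      by (auto simp: ProjPerp_def)
    ultimately show ?thesis
      using pos by (auto simp: g_def intro: add_pos_nonneg add_nonneg_pos)
  qed
  ultimately have g: "is_inner_product g"
    using g_commute unfolding is_inner_product_def by blast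

  \<comment> \<open>The gradient of \<psi>\<close>
  have "((\<lambda>y. (1/2) * (c y \<bullet> c y)) has_derivative (\<lambda>\<xi>. c x \<bullet> ?A \<xi>)) (at x)"
    by (auto intro!: derivative_eq_intros deriv simp: inner_commute)
  then have \<psi>: "(\<psi> has_derivative (\<lambda>\<xi>. c x \<bullet> ?A \<xi>)) (at x)"
    by (simp add: \<psi>_def power2_norm_eq_inner)
  have "g w \<xi> = c x \<bullet> ?A \<xi>" for \<xi>
  proof -
    have "g w \<xi> = H (c x) \<bullet> inv H (?A \<xi>)"
      by (simp add: g_def Proj_w G_N A_Perp A_w)
    \<comment> \<open>Symmetry moves \<open>H\<close> to the other factor, where it cancels the
      inverse built into \<open>G_N\<close>.\<close>
    also have "\<dots> = c x \<bullet> H (inv H (?A \<xi>))"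
      using H(2) by (simp add: symmetric_on_def)
    finally show ?thesis
      using bijH by (simp add: bij_is_surj surj_f_inv_f)
  qed
  then have "gradient_wrt g \<psi> x = w"
    by (intro gradient_wrt_unique[OF g \<psi>])
  moreover have "d_N = - w"
    by (simp add: d_N_def w_def)
  ultimately show ?thesis
    using step symN posN g by (simp add: p_def)
qed

end
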